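(* Let $(F,P)$ be an almost biparacomplex structure on a manifold $M$ and let $(V_1,V_2,V_3)$ be its associated $\alpha$-structure, so $V_1=\ker(F-\mathrm{Id})$, $V_2=\ker(F+\mathrm{Id})$, $V_3=\ker(P-\mathrm{Id})$. Then there exists a unique linear connection $\nabla$ on $M$ satisfying both conditions: (i) $\nabla F=0=\nabla P$; (ii) $T(X,Y)=0$ for all $X\in V_1$, $Y\in V_2$, where $T$ denotes the torsion tensor field of $\nabla$.
   Context: Manifolds and tensor fields are $C^\infty$; manifolds are second countable. An almost biparacomplex structure on $M$ is a pair $(F,P)$ of tensor fields of type $(1,1)$ with $F^2=P^2=\mathrm{Id}$ and $F\circ P+P\circ F=0$. (It follows that $\dim M=2n$ is even and the eigendistributions of $F$ and $P$ for $\pm1$ all have rank $n$.) The torsion is $T(X,Y)=\nabla_XY-\nabla_YX-[X,Y]$. Here "$X\in V_i$" for a vector field means that $X$ is a section of the distribution $V_i$. *)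

theory Defs
  imports "HOL-Analysis.Analysis" "HOL-Library.Function_Algebras"
begin

text \<open>
  The model space of dimension \<open>n\<close> is the library's \<^const>\<open>Euclidean_space\<close> \<open>n\<close>: sequences
  \<open>nat \<Rightarrow> real\<close> supported on the indices below \<open>n\<close>, with the product topology. In this way the
  dimension is an ordinary natural number, and \<open>n = 0\<close> is included. Only the coordinates below \<open>n\<close>
  are differentiated; for \<open>x\<close> in an open set \<open>U\<close> of the model space, \<open>x(i := t)\<close> stays in \<open>U\<close> for
  \<open>t\<close> near \<open>x i\<close>, so that values outside \<open>U\<close> do not matter.
\<close>

definition partial_deriv :: "nat \<Rightarrow> ((nat \<Rightarrow> real) \<Rightarrow> real) \<Rightarrow> (nat \<Rightarrow> real) \<Rightarrow> real" where
  "partial_deriv i f x = deriv (\<lambda>t. f (x(i := t))) (x i)"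

primrec Ck_on :: "nat \<Rightarrow> nat \<Rightarrow> (nat \<Rightarrow> real) set \<Rightarrow> ((nat \<Rightarrow> real) \<Rightarrow> real) \<Rightarrow> bool" where
  "Ck_on n 0 U f \<longleftrightarrow> continuous_on U f"
| "Ck_on n (Suc k) U f \<longleftrightarrow> continuous_on U f \<and>
     (\<forall>i<n. (\<forall>x\<in>U. (\<lambda>t. f (x(i := t))) field_differentiable at (x i)) \<and>
            Ck_on n k U (partial_deriv i f))"

definition smooth_on :: "nat \<Rightarrow> (nat \<Rightarrow> real) set \<Rightarrow> ((nat \<Rightarrow> real) \<Rightarrow> real) \<Rightarrow> bool" where
  "smooth_on n U f \<longleftrightarrow> (\<forall>k. Ck_on n k U f)"


type_synonym 'a atlas = "('a set \<times> ('a \<Rightarrow> nat \<Rightarrow> real)) set"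

definition chart :: "nat \<Rightarrow> 'a::topological_space set \<Rightarrow> ('a \<Rightarrow> nat \<Rightarrow> real) \<Rightarrow> bool" where
  "chart n U \<phi> \<longleftrightarrow> open U \<and> openin (Euclidean_space n) (\<phi> ` U) \<and>
     homeomorphism U (\<phi> ` U) \<phi> (inv_into U \<phi>)"

text \<open>
  The manifold is the whole type \<open>'a\<close>; that it is Hausdorff and second countable is expressed by
  the type classes. The atlas need not be maximal: the notions below are the same for an
  atlas and for the maximal atlas containing it.
\<close>

definition smooth_manifold ::
    "nat \<Rightarrow> 'a::{t2_space, second_countable_topology} atlas \<Rightarrow> bool" where
  "smooth_manifold n A \<longleftrightarrow>
     (\<forall>(U, \<phi>)\<in>A. chart n U \<phi>) \<and> (\<Union>(U, \<phi>)\<in>A. U) = UNIV \<and>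
     (\<forall>(U, \<phi>)\<in>A. \<forall>(V, \<psi>)\<in>A. \<forall>i<n.
        smooth_on n (\<phi> ` (U \<inter> V)) (\<lambda>x. \<psi> (inv_into U \<phi> x) i))"

definition smooth_functions :: "nat \<Rightarrow> 'a atlas \<Rightarrow> ('a \<Rightarrow> real) set" where
  "smooth_functions n A = {f. \<forall>(U, \<phi>)\<in>A. smooth_on n (\<phi> ` U) (\<lambda>x. f (inv_into U \<phi> x))}"


text \<open>
  A tangent vector at \<open>p\<close> is a derivation at \<open>p\<close> of the algebra of smooth functions. HOL functions
  are total, so it is given the conventional value 0 on functions that are not smooth; this makes
  equality of tangent vectors mean equality on smooth functions, and is preserved by the pointwise
  vector space operations.
\<close>

type_synonym 'a tangent_vector = "('a \<Rightarrow> real) \<Rightarrow> real"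

definition tangent_space :: "nat \<Rightarrow> 'a atlas \<Rightarrow> 'a \<Rightarrow> 'a tangent_vector set" where
  "tangent_space n A p = {v.
     (\<forall>f. f \<notin> smooth_functions n A \<longrightarrow> v f = 0) \<and>
     (\<forall>f\<in>smooth_functions n A. \<forall>g\<in>smooth_functions n A. v (f + g) = v f + v g) \<and>
     (\<forall>c. \<forall>f\<in>smooth_functions n A. v (\<lambda>q. c * f q) = c * v f) \<and>
     (\<forall>f\<in>smooth_functions n A. \<forall>g\<in>smooth_functions n A. v (f * g) = v f * g p + f p * v g)}"

type_synonym 'a vector_field = "'a \<Rightarrow> 'a tangent_vector"

definition vector_fields :: "nat \<Rightarrow> 'a atlas \<Rightarrow> 'a vector_field set" where
  "vector_fields n A = {X. (\<forall>p. X p \<in> tangent_space n A p) \<and>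
     (\<forall>f\<in>smooth_functions n A. (\<lambda>p. X p f) \<in> smooth_functions n A)}"

definition fscale :: "('a \<Rightarrow> real) \<Rightarrow> 'a vector_field \<Rightarrow> 'a vector_field" where
  "fscale f X = (\<lambda>p g. f p * X p g)"

definition lie_bracket :: "'a vector_field \<Rightarrow> 'a vector_field \<Rightarrow> 'a vector_field" where
  "lie_bracket X Y = (\<lambda>p f. X p (\<lambda>q. Y q f) - Y p (\<lambda>q. X q f))"


text \<open>
  A tensor field of type (1,1) is a field of endomorphisms of the tangent spaces, smooth in the
  sense that it takes smooth vector fields to smooth vector fields. Its values outside the tangent
  spaces are irrelevant and never used.
\<close>

type_synonym 'a tensor11 = "'a \<Rightarrow> 'a tangent_vector \<Rightarrow> 'a tangent_vector"

definition tensor_act :: "'a tensor11 \<Rightarrow> 'a vector_field \<Rightarrow> 'a vector_field" where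
  "tensor_act F X = (\<lambda>p. F p (X p))"

definition tensor_fields11 :: "nat \<Rightarrow> 'a atlas \<Rightarrow> 'a tensor11 set" where
  "tensor_fields11 n A = {F.
     (\<forall>p. \<forall>v\<in>tangent_space n A p. F p v \<in> tangent_space n A p) \<and>
     (\<forall>p. \<forall>v\<in>tangent_space n A p. \<forall>w\<in>tangent_space n A p. F p (v + w) = F p v + F p w) \<and>
     (\<forall>p c. \<forall>v\<in>tangent_space n A p. F p (\<lambda>f. c * v f) = (\<lambda>f. c * F p v f)) \<and>
     (\<forall>X\<in>vector_fields n A. tensor_act F X \<in> vector_fields n A)}"

definition id_tensor :: "'a tensor11" where
  "id_tensor = (\<lambda>p v. v)"

definition almost_biparacomplex :: "nat \<Rightarrow> 'a atlas \<Rightarrow> 'a tensor11 \<Rightarrow> 'a tensor11 \<Rightarrow> bool" where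
  "almost_biparacomplex n A F P \<longleftrightarrow>
     F \<in> tensor_fields11 n A \<and> P \<in> tensor_fields11 n A \<and>
     (\<forall>p. \<forall>v\<in>tangent_space n A p.
        F p (F p v) = v \<and> P p (P p v) = v \<and> F p (P p v) + P p (F p v) = 0)"


type_synonym 'a distribution = "'a \<Rightarrow> 'a tangent_vector set"

definition ker_distribution :: "nat \<Rightarrow> 'a atlas \<Rightarrow> 'a tensor11 \<Rightarrow> 'a distribution" where
  "ker_distribution n A K = (\<lambda>p. {v \<in> tangent_space n A p. K p v = 0})"

definition alpha_structure ::
    "nat \<Rightarrow> 'a atlas \<Rightarrow> 'a tensor11 \<Rightarrow> 'a tensor11 \<Rightarrow>
     'a distribution \<times> 'a distribution \<times> 'a distribution" where
  "alpha_structure n A F P =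
     (ker_distribution n A (F - id_tensor),
      ker_distribution n A (F + id_tensor),
      ker_distribution n A (P - id_tensor))"

definition sections :: "nat \<Rightarrow> 'a atlas \<Rightarrow> 'a distribution \<Rightarrow> 'a vector_field set" where
  "sections n A V = {X \<in> vector_fields n A. \<forall>p. X p \<in> V p}"


text \<open>
  \<open>D X Y\<close> is the covariant derivative of \<open>Y\<close> along \<open>X\<close>. The extensional function space makes
  equality of connections mean equality on smooth vector fields.
\<close>

type_synonym 'a connection = "'a vector_field \<Rightarrow> 'a vector_field \<Rightarrow> 'a vector_field"

definition linear_connection :: "nat \<Rightarrow> 'a atlas \<Rightarrow> 'a connection \<Rightarrow> bool" where
  "linear_connection n A D \<longleftrightarrow>
     D \<in> vector_fields n A \<rightarrow>\<^sub>E (vector_fields n A \<rightarrow>\<^sub>E vector_fields n A) \<and>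
     (\<forall>X\<in>vector_fields n A. \<forall>X'\<in>vector_fields n A. \<forall>Y\<in>vector_fields n A.
        D (X + X') Y = D X Y + D X' Y) \<and>
     (\<forall>f\<in>smooth_functions n A. \<forall>X\<in>vector_fields n A. \<forall>Y\<in>vector_fields n A.
        D (fscale f X) Y = fscale f (D X Y)) \<and>
     (\<forall>X\<in>vector_fields n A. \<forall>Y\<in>vector_fields n A. \<forall>Y'\<in>vector_fields n A.
        D X (Y + Y') = D X Y + D X Y') \<and>
     (\<forall>f\<in>smooth_functions n A. \<forall>X\<in>vector_fields n A. \<forall>Y\<in>vector_fields n A.
        D X (fscale f Y) = fscale (\<lambda>p. X p f) Y + fscale f (D X Y))"

definition cov_deriv11 ::
    "'a connection \<Rightarrow> 'a tensor11 \<Rightarrow> 'a vector_field \<Rightarrow> 'a vector_field \<Rightarrow> 'a vector_field" where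
  "cov_deriv11 D F X Y = D X (tensor_act F Y) - tensor_act F (D X Y)"

definition parallel11 :: "nat \<Rightarrow> 'a atlas \<Rightarrow> 'a connection \<Rightarrow> 'a tensor11 \<Rightarrow> bool" where
  "parallel11 n A D F \<longleftrightarrow>
     (\<forall>X\<in>vector_fields n A. \<forall>Y\<in>vector_fields n A. cov_deriv11 D F X Y = 0)"

definition torsion :: "'a connection \<Rightarrow> 'a vector_field \<Rightarrow> 'a vector_field \<Rightarrow> 'a vector_field" where
  "torsion D X Y = D X Y - D Y X - lie_bracket X Y"

end

theory Submission
  imports Defs
begin

text \<open>
  A connection preserving \<open>F\<close> preserves both eigendistributions \<open>V1\<close>, \<open>V2\<close>, so for \<open>X\<close> in \<open>V1\<close> and
  \<open>Y\<close> in \<open>V2\<close> vanishing torsion means that \<open>\<nabla>\<^sub>X Y\<close> and \<open>\<nabla>\<^sub>Y X\<close> are the \<open>V2\<close>-part of \<open>[X, Y]\<close> and the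
  \<open>V1\<close>-part of \<open>[Y, X]\<close>. As \<open>P\<close> is parallel and exchanges \<open>V1\<close> and \<open>V2\<close>, the derivative of a section
  along its own eigendistribution is obtained from these by conjugation with \<open>P\<close>. The resulting
  formula determines the connection, and it does define one: the terms violating tensoriality in
  the Lie bracket are killed by the projections.
\<close>

section \<open>The algebra of smooth functions\<close>

text \<open>\<open>U\<close> is the trace of an open \<open>T\<close> on the sequences vanishing
  from index \<open>n\<close> on. Moving a coordinate below \<open>n\<close> stays among these
  sequences, and the coordinate line is continuous, so it remains in \<open>T\<close> near
  \<open>x i\<close>.\<close>

lemma eventually_fun_upd_in:
  assumes "openin (Euclidean_space n) U" "x \<in> U" "i < n"
  shows "\<forall>\<^sub>F t in nhds (x i). x(i := t) \<in> U"
proof -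
  obtain T where T: "open T" "U = T \<inter> {x. \<forall>i\<ge>n. x i = 0}"
    using assms(1) unfolding Euclidean_space_def openin_subtopology euclidean_product_topology
    by auto
  have "continuous_on UNIV (\<lambda>t. x(i := t))"
  proof (rule continuous_on_coordinatewise_then_product)
    show "continuous_on UNIV (\<lambda>t. (x(i := t)) j)" for j
      by (cases "j = i") simp_all
  qed
  then have "open ((\<lambda>t. x(i := t)) -` T)"
    using T(1) open_vimage by blast
  moreover have "x i \<in> (\<lambda>t. x(i := t)) -` T"
    using assms(2) T(2) by auto
  ultimately have "\<forall>\<^sub>F t in nhds (x i). x(i := t) \<in> T"
    unfolding eventually_nhds by blast
  then show ?thesis
    by eventually_elim (use assms(2,3) T(2) in auto)
qed

lemma partial_deriv_cong:
  assumes "openin (Euclidean_space n) U" "\<And>x. x \<in> U \<Longrightarrow> f x = g x" "x \<in> U" "i < n"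
  shows "partial_deriv i f x = partial_deriv i g x"
    and "(\<lambda>t. f (x(i := t))) field_differentiable at (x i) \<longleftrightarrow>
         (\<lambda>t. g (x(i := t))) field_differentiable at (x i)"
proof -
  have ev: "\<forall>\<^sub>F t in nhds (x i). f (x(i := t)) = g (x(i := t))"
    using eventually_fun_upd_in[OF assms(1,3,4)] by eventually_elim (rule assms(2))
  then show "partial_deriv i f x = partial_deriv i g x"
    unfolding partial_deriv_def by (rule deriv_cong_ev) simp
  show "(\<lambda>t. f (x(i := t))) field_differentiable at (x i) \<longleftrightarrow>
        (\<lambda>t. g (x(i := t))) field_differentiable at (x i)"
    unfolding field_differentiable_def
    by (intro iff_exI DERIV_cong_ev ev refl)
qed

text \<open>The sum and product rules for \<open>partial_deriv\<close> are available only on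
  \<open>U\<close>. This lemma lets the derivative of a combination be replaced by the expected
  formula although the two may differ elsewhere.\<close>

lemma Ck_on_cong:
  assumes "openin (Euclidean_space n) U" "\<And>x. x \<in> U \<Longrightarrow> f x = g x"
  shows "Ck_on n k U f \<longleftrightarrow> Ck_on n k U g"
  using assms(2)
proof (induction k arbitrary: f g)
  case 0
  then show ?case by (simp cong: continuous_on_cong)
next
  case (Suc k)
  have "continuous_on U f \<longleftrightarrow> continuous_on U g"
    using Suc.prems by (simp cong: continuous_on_cong)
  moreover have "Ck_on n k U (partial_deriv i f) \<longleftrightarrow> Ck_on n k U (partial_deriv i g)" if "i < n" for i
    by (rule Suc.IH) (rule partial_deriv_cong(1)[OF assms(1) Suc.prems _ that])
  moreover have "(\<forall>x\<in>U. (\<lambda>t. f (x(i := t))) field_differentiable at (x i)) \<longleftrightarrow>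
      (\<forall>x\<in>U. (\<lambda>t. g (x(i := t))) field_differentiable at (x i))" if "i < n" for i
    by (rule ball_cong[OF refl]) (rule partial_deriv_cong(2)[OF assms(1) Suc.prems _ that])
  ultimately show ?case by simp
qed

lemma Ck_on_SucD: "Ck_on n (Suc k) U f \<Longrightarrow> Ck_on n k U f"
  by (induction k arbitrary: f) auto

lemma Ck_on_const: "Ck_on n k U (\<lambda>x. c)"
proof (induction k arbitrary: c)
  case (Suc k)
  have "partial_deriv i (\<lambda>x. c) = (\<lambda>x. 0)" for i
    by (simp add: partial_deriv_def fun_eq_iff)
  with Suc show ?case by simp
qed simp

lemma Ck_on_add:
  assumes "openin (Euclidean_space n) U" "Ck_on n k U f" "Ck_on n k U g"
  shows "Ck_on n k U (\<lambda>x. f x + g x)"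
  using assms(2,3)
proof (induction k arbitrary: f g)
  case 0
  then show ?case by (simp add: continuous_on_add)
next
  case (Suc k)
  have "Ck_on n k U (partial_deriv i (\<lambda>x. f x + g x))" if "i < n" for i
  proof -
    have "partial_deriv i (\<lambda>x. f x + g x) x = partial_deriv i f x + partial_deriv i g x" if "x \<in> U" for x
      unfolding partial_deriv_def using Suc.prems \<open>i < n\<close> that by (intro deriv_add) auto
    with Suc.IH[of "partial_deriv i f" "partial_deriv i g"] Suc.prems that show ?thesis
      by (simp cong: Ck_on_cong[OF assms(1)])
  qed
  with Suc.prems show ?case
    by (auto intro: continuous_on_add field_differentiable_add)
qed

lemma Ck_on_mult:
  assumes "openin (Euclidean_space n) U" "Ck_on n k U f" "Ck_on n k U g"
  shows "Ck_on n k U (\<lambda>x. f x * g x)"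
  using assms(2,3)
proof (induction k arbitrary: f g)
  case 0
  then show ?case by (simp add: continuous_on_mult)
next
  case (Suc k)
  have "Ck_on n k U (partial_deriv i (\<lambda>x. f x * g x))" if "i < n" for i
  proof -
    have "partial_deriv i (\<lambda>x. f x * g x) x = f x * partial_deriv i g x + partial_deriv i f x * g x"
      if "x \<in> U" for x
    proof -
      have "(\<lambda>t. f (x(i := t))) field_differentiable at (x i)"
        "(\<lambda>t. g (x(i := t))) field_differentiable at (x i)"
        using Suc.prems \<open>i < n\<close> that by auto
      from deriv_mult[OF this] show ?thesis
        unfolding partial_deriv_def by simp
    qed
    moreover have "Ck_on n k U (\<lambda>x. f x * partial_deriv i g x + partial_deriv i f x * g x)"
      \<comment> \<open>The product rule pairs a derivative with an undifferentiated factor, whose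
        order has to be lowered from \<open>Suc k\<close> to \<open>k\<close> by
        \<open>Ck_on_SucD\<close>.\<close>
      using Suc.prems that by (intro Ck_on_add[OF assms(1)] Suc.IH) (auto intro: Ck_on_SucD)
    ultimately show ?thesis
      by (simp cong: Ck_on_cong[OF assms(1)])
  qed
  with Suc.prems show ?case
    by (auto intro: continuous_on_mult field_differentiable_mult)
qed

lemma smooth_functions_const: "(\<lambda>p. c) \<in> smooth_functions n A"
  by (auto simp: smooth_functions_def smooth_on_def Ck_on_const)

section \<open>Ring operations on smooth functions of a manifold\<close>

locale smooth_atlas =
  fixes n :: nat and A :: "'a::{t2_space, second_countable_topology} atlas"
  assumes manifold: "smooth_manifold n A"
begin

abbreviation SF :: "('a \<Rightarrow> real) set" where
  "SF \<equiv> smooth_functions n A"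

abbreviation VF :: "'a vector_field set" where
  "VF \<equiv> vector_fields n A"

lemma chart_image_open: "(U, \<phi>) \<in> A \<Longrightarrow> openin (Euclidean_space n) (\<phi> ` U)"
  using manifold by (auto simp: smooth_manifold_def chart_def)

lemma smooth_functions_add:
  "f \<in> SF \<Longrightarrow> g \<in> SF \<Longrightarrow> (\<lambda>p. f p + g p) \<in> SF"
  by (fastforce simp: smooth_functions_def smooth_on_def intro: Ck_on_add chart_image_open)

lemma smooth_functions_mult:
  "f \<in> SF \<Longrightarrow> g \<in> SF \<Longrightarrow> (\<lambda>p. f p * g p) \<in> SF"
  by (fastforce simp: smooth_functions_def smooth_on_def intro: Ck_on_mult chart_image_open)

lemma smooth_functions_minus: "f \<in> SF \<Longrightarrow> (\<lambda>p. - f p) \<in> SF"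
  using smooth_functions_mult[OF smooth_functions_const[of "-1"]] by simp

lemma smooth_functions_diff:
  "f \<in> SF \<Longrightarrow> g \<in> SF \<Longrightarrow> (\<lambda>p. f p - g p) \<in> SF"
  using smooth_functions_add[OF _ smooth_functions_minus] by simp


section \<open>Vector fields and tensor fields\<close>

lemma vector_field_smooth: "X \<in> VF \<Longrightarrow> f \<in> SF \<Longrightarrow> (\<lambda>p. X p f) \<in> SF"
  by (simp add: vector_fields_def)

lemma vector_field_tangent: "X \<in> VF \<Longrightarrow> X p \<in> tangent_space n A p"
  by (simp add: vector_fields_def)

lemma vector_field_nonsmooth: "X \<in> VF \<Longrightarrow> f \<notin> SF \<Longrightarrow> X p f = 0"
  by (simp add: vector_fields_def tangent_space_def)

lemma vector_field_apply_add:
  assumes "X \<in> VF" "f \<in> SF" "g \<in> SF"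
  shows "X p (\<lambda>q. f q + g q) = X p f + X p g"
proof -
  have "X p (f + g) = X p f + X p g"
    using assms by (simp add: vector_fields_def tangent_space_def)
  then show ?thesis by (simp add: plus_fun_def)
qed

lemma vector_field_apply_mult:
  assumes "X \<in> VF" "f \<in> SF" "g \<in> SF"
  shows "X p (\<lambda>q. f q * g q) = X p f * g p + f p * X p g"
proof -
  have "X p (f * g) = X p f * g p + f p * X p g"
    using assms by (simp add: vector_fields_def tangent_space_def)
  then show ?thesis by (simp add: times_fun_def)
qed

lemma vector_field_apply_cmult:
  "X \<in> VF \<Longrightarrow> f \<in> SF \<Longrightarrow> X p (\<lambda>q. c * f q) = c * X p f"
  by (simp add: vector_fields_def tangent_space_def)

lemma vector_field_apply_0: "X \<in> VF \<Longrightarrow> X p (\<lambda>q. 0) = 0"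
  using vector_field_apply_cmult[of X "\<lambda>q. 0" p 0] by (simp add: smooth_functions_const)

text \<open>The composite instances are stated separately because the general rules are not
  higher-order patterns and so do not rewrite iterated derivatives.\<close>

lemma vector_field_apply2_add:
  "X \<in> VF \<Longrightarrow> Y \<in> VF \<Longrightarrow> Z \<in> VF \<Longrightarrow> f \<in> SF \<Longrightarrow> g \<in> SF \<Longrightarrow>
    X p (\<lambda>q. Y q f + Z q g) = X p (\<lambda>q. Y q f) + X p (\<lambda>q. Z q g)"
  by (rule vector_field_apply_add) (simp_all add: vector_field_smooth)

lemma vector_field_apply2_cmult:
  "X \<in> VF \<Longrightarrow> Y \<in> VF \<Longrightarrow> f \<in> SF \<Longrightarrow> X p (\<lambda>q. c * Y q f) = c * X p (\<lambda>q. Y q f)"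
  by (rule vector_field_apply_cmult) (simp_all add: vector_field_smooth)

lemma vector_field_apply2_mult:
  "X \<in> VF \<Longrightarrow> Y \<in> VF \<Longrightarrow> f \<in> SF \<Longrightarrow> g \<in> SF \<Longrightarrow>
    X p (\<lambda>q. f q * Y q g) = X p f * Y p g + f p * X p (\<lambda>q. Y q g)"
  by (rule vector_field_apply_mult) (simp_all add: vector_field_smooth)

text \<open>The two cross terms are exchanged when \<open>X\<close> and \<open>Y\<close> are
  swapped, so they cancel in the commutator; this is why the bracket is again a derivation.\<close>

lemma vector_field_apply2_product:
  assumes "X \<in> VF" "Y \<in> VF" "f \<in> SF" "g \<in> SF"
  shows "X p (\<lambda>q. Y q (\<lambda>r. f r * g r)) =
    X p (\<lambda>q. Y q f) * g p + Y p f * X p g + X p f * Y p g + f p * X p (\<lambda>q. Y q g)"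
proof -
  have "X p (\<lambda>q. Y q f * g q + f q * Y q g) =
      X p (\<lambda>q. Y q f * g q) + X p (\<lambda>q. f q * Y q g)"
    using assms by (intro vector_field_apply_add) (simp_all add: smooth_functions_mult vector_field_smooth)
  moreover have "X p (\<lambda>q. Y q f * g q) = X p (\<lambda>q. Y q f) * g p + Y p f * X p g"
    using assms by (intro vector_field_apply_mult) (simp_all add: vector_field_smooth)
  moreover have "X p (\<lambda>q. f q * Y q g) = X p f * Y p g + f p * X p (\<lambda>q. Y q g)"
    using assms by (rule vector_field_apply2_mult)
  moreover have "Y q (\<lambda>r. f r * g r) = Y q f * g q + f q * Y q g" for q
    using assms(2-) by (rule vector_field_apply_mult)
  ultimately show ?thesis
    by simp
qed

lemma vector_fieldI:
  assumes "\<And>p f. f \<notin> SF \<Longrightarrow> X p f = 0"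
    and "\<And>p f g. f \<in> SF \<Longrightarrow> g \<in> SF \<Longrightarrow> X p (\<lambda>q. f q + g q) = X p f + X p g"
    and "\<And>p c f. f \<in> SF \<Longrightarrow> X p (\<lambda>q. c * f q) = c * X p f"
    and "\<And>p f g. f \<in> SF \<Longrightarrow> g \<in> SF \<Longrightarrow> X p (\<lambda>q. f q * g q) = X p f * g p + f p * X p g"
    and "\<And>f. f \<in> SF \<Longrightarrow> (\<lambda>p. X p f) \<in> SF"
  shows "X \<in> VF"
  using assms by (simp add: vector_fields_def tangent_space_def plus_fun_def times_fun_def)

lemma vector_fields_add: "X \<in> VF \<Longrightarrow> Y \<in> VF \<Longrightarrow> X + Y \<in> VF"
  by (rule vector_fieldI)
    (simp_all add: vector_field_nonsmooth vector_field_apply_add vector_field_apply_mult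
      vector_field_apply_cmult vector_field_smooth smooth_functions_add algebra_simps)

lemma vector_fields_fscale: "f \<in> SF \<Longrightarrow> X \<in> VF \<Longrightarrow> fscale f X \<in> VF"
  by (rule vector_fieldI)
    (simp_all add: fscale_def vector_field_nonsmooth vector_field_apply_add vector_field_apply_mult
      vector_field_apply_cmult vector_field_smooth smooth_functions_mult algebra_simps)

lemma vector_fields_zero: "0 \<in> VF"
  by (rule vector_fieldI) (simp_all add: smooth_functions_const)

lemma vector_fields_minus: "X \<in> VF \<Longrightarrow> - X \<in> VF"
  by (rule vector_fieldI)
    (simp_all add: vector_field_nonsmooth vector_field_apply_add vector_field_apply_mult
      vector_field_apply_cmult vector_field_smooth smooth_functions_minus algebra_simps)

lemma vector_fields_lie_bracket:
  assumes "X \<in> VF" "Y \<in> VF"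
  shows "lie_bracket X Y \<in> VF"
  \<comment> \<open>For non-smooth \<open>f\<close> both inner functions are identically 0, so
    \<open>vector_field_apply_0\<close> yields the conventional value.\<close>
  using assms
  by (intro vector_fieldI)
    (simp_all add: lie_bracket_def vector_field_nonsmooth vector_field_apply_0
      vector_field_apply_add vector_field_apply_cmult vector_field_apply2_add
      vector_field_apply2_cmult vector_field_apply2_product vector_field_smooth
      smooth_functions_diff algebra_simps)

text \<open>Off \<open>SF\<close> both fields take the conventional value 0.\<close>

lemma vector_field_eqI:
  assumes "X \<in> VF" "Y \<in> VF" "\<And>p f. f \<in> SF \<Longrightarrow> X p f = Y p f"
  shows "X = Y"
  using assms by (metis ext vector_field_nonsmooth)

lemmas vector_fields_closed =
  vector_fields_add vector_fields_fscale vector_fields_zero vector_fields_minus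
  vector_fields_lie_bracket

section \<open>Additivity and Leibniz rules of the Lie bracket\<close>

lemma lie_bracket_add_right:
  assumes "X \<in> VF" "Y \<in> VF" "Z \<in> VF"
  shows "lie_bracket X (Y + Z) = lie_bracket X Y + lie_bracket X Z"
proof (rule vector_field_eqI)
  show "lie_bracket X (Y + Z) p f = (lie_bracket X Y + lie_bracket X Z) p f" if "f \<in> SF" for p f
    using assms that by (simp add: lie_bracket_def vector_field_apply2_add)
qed (use assms in \<open>simp_all add: vector_fields_closed\<close>)

lemma lie_bracket_fscale_right:
  assumes "f \<in> SF" "X \<in> VF" "Y \<in> VF"
  shows "lie_bracket X (fscale f Y) = fscale (\<lambda>p. X p f) Y + fscale f (lie_bracket X Y)"
proof (rule vector_field_eqI)
  show "lie_bracket X (fscale f Y) p g =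
      (fscale (\<lambda>p. X p f) Y + fscale f (lie_bracket X Y)) p g" if "g \<in> SF" for p g
    using assms that
    by (simp add: lie_bracket_def fscale_def vector_field_apply2_mult algebra_simps)
qed (use assms in \<open>simp_all add: vector_fields_closed vector_field_smooth\<close>)

lemma lie_bracket_swap: "lie_bracket X Y = - lie_bracket Y X"
  by (simp add: lie_bracket_def fun_eq_iff)

lemma lie_bracket_add_left:
  "X \<in> VF \<Longrightarrow> Y \<in> VF \<Longrightarrow> Z \<in> VF \<Longrightarrow> lie_bracket (X + Y) Z = lie_bracket X Z + lie_bracket Y Z"
  using lie_bracket_add_right[of Z X Y] lie_bracket_swap[of _ Z] by simp

lemma lie_bracket_fscale_left:
  assumes "f \<in> SF" "X \<in> VF" "Y \<in> VF"
  shows "lie_bracket (fscale f X) Y = fscale f (lie_bracket X Y) + fscale (\<lambda>p. - Y p f) X"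
  using lie_bracket_fscale_right[OF assms(1,3,2)] lie_bracket_swap[of _ Y]
  by (simp add: fscale_def fun_eq_iff)

lemma lie_bracket_zero_right: "X \<in> VF \<Longrightarrow> lie_bracket X 0 = 0"
  by (simp add: lie_bracket_def fun_eq_iff vector_field_apply_0)

lemma lie_bracket_minus_right:
  "X \<in> VF \<Longrightarrow> Y \<in> VF \<Longrightarrow> lie_bracket X (- Y) = - lie_bracket X Y"
  using lie_bracket_add_right[of X Y "- Y"]
  by (simp add: vector_fields_minus lie_bracket_zero_right eq_neg_iff_add_eq_0 add.commute)

lemma lie_bracket_zero_left: "X \<in> VF \<Longrightarrow> lie_bracket 0 X = 0"
  by (simp add: lie_bracket_def fun_eq_iff vector_field_apply_0)

section \<open>Action of endomorphism fields on vector fields\<close>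

context
  fixes K :: "'a tensor11"
  assumes K: "K \<in> tensor_fields11 n A"
begin

lemma tensor_act_closed: "X \<in> VF \<Longrightarrow> tensor_act K X \<in> VF"
  using K by (simp add: tensor_fields11_def)

lemma tensor_act_add: "X \<in> VF \<Longrightarrow> Y \<in> VF \<Longrightarrow> tensor_act K (X + Y) = tensor_act K X + tensor_act K Y"
  using K by (simp add: tensor_fields11_def tensor_act_def fun_eq_iff vector_field_tangent)

text \<open>At each point \<open>f\<close> enters only through the scalar \<open>f p\<close>, so
  real homogeneity on the tangent space gives linearity over functions.\<close>

lemma tensor_act_fscale: "X \<in> VF \<Longrightarrow> tensor_act K (fscale f X) = fscale f (tensor_act K X)"
  using K by (simp add: tensor_fields11_def tensor_act_def fscale_def fun_eq_iff vector_field_tangent)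

lemma tensor_act_zero: "tensor_act K 0 = 0"
  using tensor_act_add[of 0 0] by (simp add: vector_fields_zero)

lemma tensor_act_minus: "X \<in> VF \<Longrightarrow> tensor_act K (- X) = - tensor_act K X"
  using tensor_act_add[of X "- X"]
  by (simp add: vector_fields_minus tensor_act_zero eq_neg_iff_add_eq_0 add.commute)

end

end


section \<open>The canonical connection\<close>

locale biparacomplex = smooth_atlas n A
  for n :: nat and A :: "'a::{t2_space, second_countable_topology} atlas" +
  fixes F P :: "'a tensor11"
  assumes abp: "almost_biparacomplex n A F P"
begin

section \<open>Relations between \<open>F\<close> and \<open>P\<close>, and the eigenprojections of
  \<open>F\<close>\<close>

lemma F_tensor: "F \<in> tensor_fields11 n A" and P_tensor: "P \<in> tensor_fields11 n A"
  using abp by (simp_all add: almost_biparacomplex_def)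

abbreviation "Fa \<equiv> tensor_act F"
abbreviation "Pa \<equiv> tensor_act P"

lemmas F_simps = tensor_act_closed[OF F_tensor] tensor_act_add[OF F_tensor] tensor_act_fscale[OF F_tensor]
  tensor_act_minus[OF F_tensor]
lemmas P_simps = tensor_act_closed[OF P_tensor] tensor_act_add[OF P_tensor] tensor_act_fscale[OF P_tensor]
  tensor_act_minus[OF P_tensor] tensor_act_zero[OF P_tensor]

lemma FF: "X \<in> VF \<Longrightarrow> Fa (Fa X) = X" and PP: "X \<in> VF \<Longrightarrow> Pa (Pa X) = X"
  using abp by (auto simp: almost_biparacomplex_def tensor_act_def vector_field_tangent)

lemma FP: "X \<in> VF \<Longrightarrow> Fa (Pa X) = - Pa (Fa X)"
  using abp
  by (auto simp: almost_biparacomplex_def tensor_act_def vector_field_tangent fun_eq_iff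
      eq_neg_iff_add_eq_0)

text \<open>For \<open>s = 1\<close> and \<open>s = -1\<close> this is the projection (Id + s F)/2
  onto the corresponding eigendistribution. With the sign as a parameter, linearity is proved once
  for both; constants are scaled by \<open>fscale\<close> so that its rules apply.\<close>

definition eig :: "real \<Rightarrow> 'a vector_field \<Rightarrow> 'a vector_field" where
  "eig s X = fscale (\<lambda>_. 1/2) (X + fscale (\<lambda>_. s) (Fa X))"

abbreviation "E1 \<equiv> eig 1"
abbreviation "E2 \<equiv> eig (-1)"

lemma eig_closed: "X \<in> VF \<Longrightarrow> eig s X \<in> VF"
  unfolding eig_def by (intro vector_fields_closed smooth_functions_const F_simps)

lemma eig_add: "X \<in> VF \<Longrightarrow> Y \<in> VF \<Longrightarrow> eig s (X + Y) = eig s X + eig s Y"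
  by (simp add: eig_def F_simps fscale_def fun_eq_iff algebra_simps)

lemma eig_minus: "X \<in> VF \<Longrightarrow> eig s (- X) = - eig s X"
  by (simp add: eig_def F_simps fscale_def fun_eq_iff algebra_simps)

lemma eig_zero: "eig s 0 = 0"
  by (simp add: eig_def tensor_act_zero[OF F_tensor] fscale_def fun_eq_iff)

lemma eig_fscale: "X \<in> VF \<Longrightarrow> eig s (fscale f X) = fscale f (eig s X)"
  by (simp add: eig_def F_simps) (simp add: fscale_def fun_eq_iff algebra_simps)

lemma eig_diff: "X \<in> VF \<Longrightarrow> Y \<in> VF \<Longrightarrow> eig s (X - Y) = eig s X - eig s Y"
  using eig_add[of X "- Y"] by (simp add: vector_fields_minus eig_minus)

lemmas closed = vector_fields_closed eig_closed tensor_act_closed[OF F_tensor] tensor_act_closed[OF P_tensor]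

lemma F_eig:
  assumes "X \<in> VF"
  shows "Fa (eig s X) = fscale (\<lambda>_. 1/2) (Fa X + fscale (\<lambda>_. s) X)"
  using assms by (simp add: eig_def F_simps closed smooth_functions_const FF)

lemma F_E1: "X \<in> VF \<Longrightarrow> Fa (E1 X) = E1 X"
  by (simp add: F_eig) (simp add: eig_def fscale_def fun_eq_iff)

lemma F_E2: "X \<in> VF \<Longrightarrow> Fa (E2 X) = - E2 X"
  by (simp add: F_eig) (simp add: eig_def fscale_def fun_eq_iff diff_divide_distrib)

lemma E1_eqI: "Fa X = X \<Longrightarrow> E1 X = X" and E2_eqI: "Fa X = - X \<Longrightarrow> E2 X = X"
  and E1_eq0I: "Fa X = - X \<Longrightarrow> E1 X = 0" and E2_eq0I: "Fa X = X \<Longrightarrow> E2 X = 0"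
  by (simp_all add: eig_def fscale_def fun_eq_iff)

lemma eig_F: "X \<in> VF \<Longrightarrow> E1 (Fa X) = E1 X" "X \<in> VF \<Longrightarrow> E2 (Fa X) = - E2 X"
  by (simp_all add: eig_def FF) (simp_all add: fscale_def fun_eq_iff diff_divide_distrib)

text \<open>Since \<open>P\<close> anticommutes with \<open>F\<close>, moving it through (Id + s
  F)/2 flips the sign \<open>s\<close>.\<close>

lemma eig_P: "X \<in> VF \<Longrightarrow> E1 (Pa X) = Pa (E2 X)" "X \<in> VF \<Longrightarrow> E2 (Pa X) = Pa (E1 X)"
  by (simp_all add: eig_def P_simps closed smooth_functions_const FP)
    (simp_all add: fscale_def fun_eq_iff)

lemma E1_plus_E2: "E1 X + E2 X = X"
  by (simp add: eig_def fscale_def fun_eq_iff add_divide_distrib diff_divide_distrib)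

lemma eig_eig:
  assumes "X \<in> VF"
  shows "E1 (E1 X) = E1 X" "E2 (E2 X) = E2 X" "E1 (E2 X) = 0" "E2 (E1 X) = 0"
  using F_E1[OF assms] F_E2[OF assms]
  by (simp_all add: E1_eqI E2_eqI E1_eq0I E2_eq0I)

text \<open>\<open>nab0\<close> is what the torsion condition forces on mixed arguments, extended by 0 to arguments
  in the same eigendistribution; conjugation by \<open>P\<close> in \<open>nab\<close> supplies the remaining part.\<close>

definition nab0 :: "'a connection" where
  "nab0 X Z = E2 (lie_bracket (E1 X) (E2 Z)) + E1 (lie_bracket (E2 X) (E1 Z))"

definition nab :: "'a connection" where
  "nab X Y = nab0 X Y + Pa (nab0 X (Pa Y))"

section \<open>The connection axioms, parallelism and torsion of \<open>nab\<close>\<close>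

lemma nab0_closed: "X \<in> VF \<Longrightarrow> Y \<in> VF \<Longrightarrow> nab0 X Y \<in> VF"
  by (simp add: nab0_def closed)

lemma nab_closed: "X \<in> VF \<Longrightarrow> Y \<in> VF \<Longrightarrow> nab X Y \<in> VF"
  by (simp add: nab_def nab0_closed closed)

lemma nab_add_left:
  assumes "X \<in> VF" "X' \<in> VF" "Y \<in> VF"
  shows "nab (X + X') Y = nab X Y + nab X' Y"
  using assms
  by (simp add: nab_def nab0_def eig_add closed lie_bracket_add_left P_simps algebra_simps)

lemma nab_add_right:
  assumes "X \<in> VF" "Y \<in> VF" "Y' \<in> VF"
  shows "nab X (Y + Y') = nab X Y + nab X Y'"
  using assms
  by (simp add: nab_def nab0_def eig_add closed lie_bracket_add_right P_simps algebra_simps)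

lemma fscale_add: "fscale f (X + Y) = fscale f X + fscale f Y"
  by (simp add: fscale_def fun_eq_iff algebra_simps)

lemma fscale_zero: "fscale f 0 = 0"
  by (simp add: fscale_def fun_eq_iff)

text \<open>The derivative term of the bracket is a multiple of \<open>E1 X\<close> in the first
  summand and of \<open>E2 X\<close> in the second; the outer projections \<open>E2\<close> and
  \<open>E1\<close> annihilate it.\<close>

lemma nab0_fscale_left:
  assumes "f \<in> SF" "X \<in> VF" "Y \<in> VF"
  shows "nab0 (fscale f X) Y = fscale f (nab0 X Y)"
  using assms
  by (simp add: nab0_def eig_fscale eig_add closed lie_bracket_fscale_left vector_field_smooth
      smooth_functions_minus eig_eig fscale_add fscale_zero)

lemma nab_fscale_left:
  assumes "f \<in> SF" "X \<in> VF" "Y \<in> VF"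
  shows "nab (fscale f X) Y = fscale f (nab X Y)"
  using assms by (simp add: nab_def nab0_fscale_left nab0_closed closed P_simps fscale_add)

text \<open>Here the derivative terms survive the outer projections. They form half of the Leibniz
  term, namely the mixed pairs of components of \<open>X\<close> and \<open>Y\<close>.\<close>

lemma nab0_fscale_right:
  assumes "f \<in> SF" "X \<in> VF" "Y \<in> VF"
  shows "nab0 X (fscale f Y) =
    fscale f (nab0 X Y) + fscale (\<lambda>p. E1 X p f) (E2 Y) + fscale (\<lambda>p. E2 X p f) (E1 Y)"
  using assms
  by (simp add: nab0_def eig_fscale eig_add closed lie_bracket_fscale_right vector_field_smooth
      eig_eig fscale_add algebra_simps)

lemma nab_fscale_right:
  assumes "f \<in> SF" "X \<in> VF" "Y \<in> VF"
  shows "nab X (fscale f Y) = fscale (\<lambda>p. X p f) Y + fscale f (nab X Y)"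
proof -
  \<comment> \<open>The conjugated summand supplies the missing pairs:
    \<open>Pa (E2 (Pa Y)) = E1 Y\<close>, and likewise with \<open>E1\<close> and \<open>E2\<close>
    exchanged.\<close>
  have "nab X (fscale f Y) =
      (fscale (\<lambda>p. E1 X p f) (E2 Y + E1 Y) + fscale (\<lambda>p. E2 X p f) (E1 Y + E2 Y))
      + fscale f (nab X Y)"
    using assms
    by (simp add: nab_def nab0_fscale_right P_simps closed nab0_closed vector_field_smooth
        eig_P PP fscale_add algebra_simps)
  also have "E2 Y + E1 Y = Y"
    by (simp add: E1_plus_E2 add.commute)
  also have "fscale (\<lambda>p. E1 X p f) Y + fscale (\<lambda>p. E2 X p f) (E1 Y + E2 Y) =
      fscale (\<lambda>p. (E1 X + E2 X) p f) Y"
    by (subst E1_plus_E2[of Y]) (simp add: fscale_def fun_eq_iff algebra_simps)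
  finally show ?thesis by (simp only: E1_plus_E2)
qed

text \<open>As P^2 = Id, replacing \<open>Y\<close> by \<open>Pa Y\<close> exchanges the two
  summands of \<open>nab\<close>, and so does applying \<open>Pa\<close>.\<close>

lemma nab_P: "X \<in> VF \<Longrightarrow> Y \<in> VF \<Longrightarrow> nab X (Pa Y) = Pa (nab X Y)"
  by (simp add: nab_def P_simps closed nab0_closed PP add.commute)

text \<open>In each summand the projection applied to the second argument is also the outermost one,
  so \<open>F\<close> acts by the same sign on both sides.\<close>

lemma nab0_F: "X \<in> VF \<Longrightarrow> Y \<in> VF \<Longrightarrow> nab0 X (Fa Y) = Fa (nab0 X Y)"
  by (simp add: nab0_def F_simps closed eig_F F_E1 F_E2 lie_bracket_minus_right eig_minus)

lemma nab0_minus: "X \<in> VF \<Longrightarrow> Y \<in> VF \<Longrightarrow> nab0 X (- Y) = - nab0 X Y"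
  by (simp add: nab0_def closed lie_bracket_minus_right eig_minus)

lemma PF: "X \<in> VF \<Longrightarrow> Pa (Fa X) = - Fa (Pa X)"
  by (simp add: FP)

text \<open>In the conjugated summand \<open>F\<close> passes \<open>P\<close> twice, and the two
  signs cancel.\<close>

lemma nab_F: "X \<in> VF \<Longrightarrow> Y \<in> VF \<Longrightarrow> nab X (Fa Y) = Fa (nab X Y)"
  by (simp add: nab_def F_simps closed nab0_closed PF nab0_minus nab0_F P_simps)

lemma nab_torsion:
  assumes "X \<in> VF" "Fa X = X" "Y \<in> VF" "Fa Y = - Y"
  shows "torsion nab X Y = 0"
proof -
  have X: "E1 X = X" "E2 X = 0" and Y: "E1 Y = 0" "E2 Y = Y"
    using assms by (simp_all add: E1_eqI E2_eqI E1_eq0I E2_eq0I)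
  \<comment> \<open>The conjugated summands vanish: \<open>Pa Y\<close> lies in the
    eigendistribution of \<open>X\<close>, and \<open>Pa X\<close> in that of \<open>Y\<close>,
    where \<open>nab0\<close> gives 0.\<close>
  have "nab X Y = E2 (lie_bracket X Y)" "nab Y X = - E1 (lie_bracket X Y)"
    using assms(1,3)
    by (simp_all add: nab_def nab0_def X Y eig_P eig_zero P_simps closed
        lie_bracket_zero_left lie_bracket_zero_right eig_minus lie_bracket_swap[of Y X])
  then show ?thesis
    using E1_plus_E2[of "lie_bracket X Y"] by (simp add: torsion_def algebra_simps)
qed

section \<open>Uniqueness of the connection\<close>

lemma connection_unique:
  assumes D: "linear_connection n A D"
    and DF: "\<And>X Y. X \<in> VF \<Longrightarrow> Y \<in> VF \<Longrightarrow> D X (Fa Y) = Fa (D X Y)"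
    and DP: "\<And>X Y. X \<in> VF \<Longrightarrow> Y \<in> VF \<Longrightarrow> D X (Pa Y) = Pa (D X Y)"
    and T: "\<And>X Y. X \<in> VF \<Longrightarrow> Fa X = X \<Longrightarrow> Y \<in> VF \<Longrightarrow> Fa Y = - Y \<Longrightarrow> torsion D X Y = 0"
    and XY: "X \<in> VF" "Y \<in> VF"
  shows "D X Y = nab X Y"
proof -
  have D_closed: "D X Y \<in> VF" if "X \<in> VF" "Y \<in> VF" for X Y
    using D that by (auto simp: linear_connection_def)
  have D_add: "D (X + X') Y = D X Y + D X' Y" "D Y (X + X') = D Y X + D Y X'"
    if "X \<in> VF" "X' \<in> VF" "Y \<in> VF" for X X' Y
    using D that by (auto simp: linear_connection_def)
  have D_minus: "D X (- Y) = - D X Y" if "X \<in> VF" "Y \<in> VF" for X Y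
  proof -
    have "D X 0 = 0"
      using D_add(2)[of 0 0 X] that by (simp add: closed)
    then show ?thesis
      using D_add(2)[of Y "- Y" X] that by (simp add: closed eq_neg_iff_add_eq_0 add.commute)
  qed
  \<comment> \<open>Parallelism of \<open>F\<close> puts \<open>D X Y\<close> in the -1 and
    \<open>D Y X\<close> in the +1 eigendistribution, so projecting the torsion equation separates
    them.\<close>
  have mixed: "E2 (lie_bracket X Y) = D X Y" "E1 (lie_bracket Y X) = D Y X"
    if "X \<in> VF" "Fa X = X" "Y \<in> VF" "Fa Y = - Y" for X Y
  proof -
    have "Fa (D X Y) = - D X Y" "Fa (D Y X) = D Y X"
      using DF[of X Y] DF[of Y X] that by (simp_all add: D_minus)
    moreover have "lie_bracket X Y = D X Y + - D Y X" "lie_bracket Y X = D Y X + - D X Y"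
      using T[OF that] lie_bracket_swap[of Y X] by (simp_all add: torsion_def algebra_simps)
    ultimately show "E2 (lie_bracket X Y) = D X Y" "E1 (lie_bracket Y X) = D Y X"
      using that
      by (simp_all add: eig_diff closed D_closed E1_eqI E2_eqI E1_eq0I E2_eq0I)
  qed
  have nab0: "nab0 X Z = D (E1 X) (E2 Z) + D (E2 X) (E1 Z)" if "Z \<in> VF" for Z
    using XY that by (simp add: nab0_def mixed closed F_E1 F_E2)
  \<comment> \<open>By parallelism of \<open>P\<close>, the conjugated \<open>nab0\<close> becomes
    the derivatives along equal eigendistributions, completing all four pairs of components.\<close>
  have "nab X Y = D (E1 X) (E2 Y) + D (E2 X) (E1 Y) + (D (E1 X) (E1 Y) + D (E2 X) (E2 Y))"
    using XY by (simp add: nab_def nab0 closed eig_P DP P_simps D_closed PP)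
  also have "\<dots> = D (E1 X + E2 X) (E1 Y + E2 Y)"
    using XY by (simp only: D_add closed) (simp add: algebra_simps)
  finally show ?thesis by (simp add: E1_plus_E2)
qed

end

theorem theorem4:
  fixes n :: nat
    and A :: "'a::{t2_space, second_countable_topology} atlas"
    and F P :: "'a tensor11"
    and V1 V2 V3 :: "'a distribution"
  assumes "smooth_manifold n A"
    and "almost_biparacomplex n A F P"
    and "(V1, V2, V3) = alpha_structure n A F P"
  shows "\<exists>!D. linear_connection n A D \<and>
           parallel11 n A D F \<and> parallel11 n A D P \<and>
           (\<forall>X\<in>sections n A V1. \<forall>Y\<in>sections n A V2. torsion D X Y = 0)"
proof -
  interpret biparacomplex n A F P
    using assms(1,2) by unfold_locales
  have V1: "X \<in> sections n A V1 \<longleftrightarrow> X \<in> VF \<and> Fa X = X" for X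
    using assms(3)
    by (auto simp: alpha_structure_def sections_def ker_distribution_def id_tensor_def
        tensor_act_def vector_field_tangent fun_eq_iff)
  have V2: "X \<in> sections n A V2 \<longleftrightarrow> X \<in> VF \<and> Fa X = - X" for X
    using assms(3)
    by (auto simp: alpha_structure_def sections_def ker_distribution_def id_tensor_def
        tensor_act_def vector_field_tangent fun_eq_iff eq_neg_iff_add_eq_0)
  \<comment> \<open>Restricting \<open>nab\<close> to \<open>VF\<close> in both arguments makes it
    extensional, as \<open>linear_connection\<close> demands.\<close>
  define D where "D = (\<lambda>X\<in>VF. \<lambda>Y\<in>VF. nab X Y)"
  have D: "D X Y = nab X Y" if "X \<in> VF" "Y \<in> VF" for X Y
    using that by (simp add: D_def)
  show ?thesis
  proof (rule ex1I[of _ D], intro conjI ballI)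
    have "D \<in> VF \<rightarrow>\<^sub>E (VF \<rightarrow>\<^sub>E VF)"
      by (auto simp: D_def nab_closed)
    then show "linear_connection n A D"
      by (simp add: linear_connection_def D closed nab_add_left nab_add_right nab_fscale_left
          nab_fscale_right)
    show "parallel11 n A D F"
      by (simp add: parallel11_def cov_deriv11_def D closed nab_F)
    show "parallel11 n A D P"
      by (simp add: parallel11_def cov_deriv11_def D closed nab_P)
    show "torsion D X Y = 0" if "X \<in> sections n A V1" "Y \<in> sections n A V2" for X Y
      using that nab_torsion[of X Y] by (simp add: V1 V2 torsion_def D)
  next
    fix D'
    assume D': "linear_connection n A D' \<and> parallel11 n A D' F \<and> parallel11 n A D' P \<and>
      (\<forall>X\<in>sections n A V1. \<forall>Y\<in>sections n A V2. torsion D' X Y = 0)"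
    then have "D' X Y = D X Y" if "X \<in> VF" "Y \<in> VF" for X Y
      using that
      by (simp add: D) (rule connection_unique, auto simp: parallel11_def cov_deriv11_def V1 V2)
    moreover have "D' \<in> VF \<rightarrow>\<^sub>E (VF \<rightarrow>\<^sub>E VF)"
      using D' by (simp add: linear_connection_def)
    moreover have "D \<in> VF \<rightarrow>\<^sub>E (VF \<rightarrow>\<^sub>E VF)"
      by (auto simp: D_def nab_closed)
    ultimately show "D' = D"
      \<comment> \<open>Extensionality is applied twice, once for each argument of the
        connection.\<close>
      by (intro PiE_ext[of D' VF "\<lambda>_. VF \<rightarrow>\<^sub>E VF" D] PiE_ext[of _ VF "\<lambda>_. VF"]) auto
  qed
qed

end
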